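(* Let $\mathbb{D}=\{z\in\mathbb{C}:|z|<1\}$ and let $\mathcal{F}$ be a family of analytic functions on $\mathbb{D}$ such that $f(0)=0$ for all $f\in\mathcal{F}$. Suppose that the family of derivatives $\mathcal{F}'=\{f':f\in\mathcal{F}\}$ is locally bounded on $\mathbb{D}$. Then $\mathcal{F}$ is locally bounded on $\mathbb{D}$.
   Context: A family $\mathcal{F}$ of analytic functions on a domain $\Omega\subset\mathbb{C}$ is locally bounded on $\Omega$ if it is uniformly bounded on each compact subset of $\Omega$: for each compact $K\subset\Omega$ there is a constant $M$ with $|f(z)|\le M$ for all $z\in K$ and all $f\in\mathcal{F}$. *)

theory Defs
  imports "HOL-Complex_Analysis.Complex_Analysis"
begin

text \<open>A family of functions on \<open>\<Omega>\<close> is a set of total functions, of which only the values on \<open>\<Omega>\<close>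
  matter. That \<open>\<Omega>\<close> is a domain and that the members are analytic on it are separate hypotheses.\<close>

definition locally_bounded_family :: "complex set \<Rightarrow> (complex \<Rightarrow> complex) set \<Rightarrow> bool" where
  "locally_bounded_family \<Omega> \<F> \<longleftrightarrow>
     (\<forall>K. compact K \<and> K \<subseteq> \<Omega> \<longrightarrow> (\<exists>M::real. \<forall>f\<in>\<F>. \<forall>z\<in>K. norm (f z) \<le> M))"

end

theory Submission
  imports Defs
begin

text \<open>As f(0) = 0, the value f(z) is the integral of f' along the segment from 0 to z, whose
  length is below 1, so |f(z)| is at most any bound for |f'| on that segment. The segments for all z
  in K lie in one compact subset of the disc, so a single bound on the derivatives serves every f
  and z. The estimate is \<open>field_differentiable_bound\<close>.\<close>

theorem theorem2p1:
  fixes \<F> :: "(complex \<Rightarrow> complex) set"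
  assumes "\<And>f. f \<in> \<F> \<Longrightarrow> f analytic_on ball 0 1"
    and "\<And>f. f \<in> \<F> \<Longrightarrow> f 0 = 0"
    and "locally_bounded_family (ball 0 1) {deriv f |f. f \<in> \<F>}"
  shows "locally_bounded_family (ball 0 1) \<F>"
  unfolding locally_bounded_family_def
proof (intro allI impI)
  fix K :: "complex set"
  assume K: "compact K \<and> K \<subseteq> ball 0 1"
  \<comment> \<open>K need be neither convex nor contain 0. The hull repairs both, stays compact,
    and stays in the disc because the disc is convex.\<close>
  define H where "H = convex hull (insert 0 K)"
  have "compact H"
    using K by (simp add: H_def compact_convex_hull)
  have "H \<subseteq> ball 0 1"
    unfolding H_def using K by (intro hull_minimal) auto
  then obtain B where "\<forall>g\<in>{deriv f |f. f \<in> \<F>}. \<forall>z\<in>H. norm (g z) \<le> B"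
    using assms(3) \<open>compact H\<close> unfolding locally_bounded_family_def by meson
  then have B: "norm (deriv f z) \<le> B" if "f \<in> \<F>" "z \<in> H" for f z
    using that by auto
  have "0 \<in> H" "K \<subseteq> H"
    unfolding H_def using hull_subset[of "insert 0 K" convex] by auto
  have "norm (f z) \<le> B" if "f \<in> \<F>" "z \<in> K" for f z
  proof -
    have "(f has_field_derivative deriv f w) (at w within H)" if "w \<in> H" for w
    proof -
      have "f analytic_on {w}"
        using analytic_on_subset[OF assms(1)[OF \<open>f \<in> \<F>\<close>], of "{w}"] \<open>H \<subseteq> ball 0 1\<close> that
        by blast
      then show ?thesis
        by (rule has_field_derivative_at_within[OF analytic_derivI])
    qed
    moreover have "convex H"
      by (simp add: H_def)
    ultimately have "norm (f z - f 0) \<le> B * norm (z - 0)"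
      using B[OF \<open>f \<in> \<F>\<close>] \<open>0 \<in> H\<close> \<open>K \<subseteq> H\<close> \<open>z \<in> K\<close>
      by (intro field_differentiable_bound[of H f "deriv f"]) blast+
    also have "\<dots> \<le> B * 1"
    proof (rule mult_left_mono)
      show "norm (z - 0) \<le> 1"
        using K \<open>z \<in> K\<close> by (auto simp: subset_eq less_imp_le)
      \<comment> \<open>B could be negative if the family were empty; here f is a member, so B
        dominates the norm of f'(0).\<close>
      show "0 \<le> B"
        using order_trans[OF norm_ge_zero B[OF \<open>f \<in> \<F>\<close> \<open>0 \<in> H\<close>]] .
    qed
    finally show ?thesis
      using assms(2)[OF \<open>f \<in> \<F>\<close>] by simp
  qed
  then show "\<exists>M. \<forall>f\<in>\<F>. \<forall>z\<in>K. norm (f z) \<le> M"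
    by blast
qed

end
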